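(* On $\mathbb{R}^{2n}$ with coordinates $z^i=(q^a,p_b)$ and canonical Poisson bracket $\{\cdot,\cdot\}_P$, consider the system $$\dot z^i=\{z^i,H\}_P,\qquad \Phi^\alpha(z)=0,\quad \alpha=1,\dots,2p<2n,$$ where $H$ is a given function and $\Phi^\alpha$ are functionally independent functions. Then $\{\Phi^\alpha,H\}_P\big|_{z^i(\tau)}=0$ for any solution $z^i(\tau)$ of the system, if any; that is, the algebraic equations $\{\Phi^\alpha,H\}_P=0$ are consequences of the system.
   Context: All objects are smooth. Repeated indices are summed and $\dot z^i=dz^i/d\tau$. The canonical Poisson bracket is $\{A,B\}_P=\frac{\partial A}{\partial q^a}\frac{\partial B}{\partial p_a}-\frac{\partial B}{\partial q^a}\frac{\partial A}{\partial p_a}$. Functions $\Phi^\alpha$, $\alpha=1,\dots,2p$, are functionally independent if $\operatorname{rank}(\partial_i\Phi^\alpha)=2p$. A solution of the system is a curve $z^i(\tau)$ satisfying the differential equations and $\Phi^\alpha(z(\tau))=0$ for all $\tau$. *)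

theory Defs
  imports "HOL-Analysis.Analysis"
begin

text \<open>
  Phase space is \<open>real ^ ('n + 'n)\<close> with \<open>CARD('n)\<close> degrees of freedom: the coordinate \<open>Inl a\<close> is
  the position \<open>q\<^sup>a\<close> and the coordinate \<open>Inr a\<close> is the conjugate momentum \<open>p\<^sub>a\<close>.
\<close>

text \<open>Only meant for open \<open>S\<close>, since the derivatives are taken at \<open>x\<close> and not within \<open>S\<close>.\<close>

fun Ck_on :: "nat \<Rightarrow> 'a::real_normed_vector set \<Rightarrow> ('a \<Rightarrow> 'b::real_normed_vector) \<Rightarrow> bool" where
  "Ck_on 0 S f \<longleftrightarrow> continuous_on S f"
| "Ck_on (Suc k) S f \<longleftrightarrow>
     (\<forall>x\<in>S. f differentiable (at x)) \<and>
     (\<forall>v. Ck_on k S (\<lambda>x. frechet_derivative f (at x) v))"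

definition smooth_on :: "'a::real_normed_vector set \<Rightarrow> ('a \<Rightarrow> 'b::real_normed_vector) \<Rightarrow> bool" where
  "smooth_on S f \<longleftrightarrow> (\<forall>k. Ck_on k S f)"

definition partial_deriv :: "'i::finite \<Rightarrow> (real ^ 'i \<Rightarrow> real) \<Rightarrow> real ^ 'i \<Rightarrow> real" where
  "partial_deriv i f z = deriv (\<lambda>t. f (z + t *\<^sub>R axis i 1)) 0"

definition poisson ::
  "(real ^ ('n::finite + 'n) \<Rightarrow> real) \<Rightarrow> (real ^ ('n + 'n) \<Rightarrow> real) \<Rightarrow> real ^ ('n + 'n) \<Rightarrow> real" where
  "poisson A B z =
     (\<Sum>a\<in>UNIV. partial_deriv (Inl a) A z * partial_deriv (Inr a) B z
            - partial_deriv (Inl a) B z * partial_deriv (Inr a) A z)"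

definition functionally_independent ::
  "('m::finite \<Rightarrow> real ^ 'i::finite \<Rightarrow> real) \<Rightarrow> bool" where
  "functionally_independent \<Phi> \<longleftrightarrow>
     (\<forall>z. rank ((\<chi> \<alpha> i. partial_deriv i (\<Phi> \<alpha>) z) :: real ^ 'i ^ 'm) = CARD('m))"

text \<open>Solutions need not be global, so a curve is defined on an open interval \<open>T\<close> of times.\<close>

definition is_solution ::
  "(real ^ ('n::finite + 'n) \<Rightarrow> real) \<Rightarrow> ('m \<Rightarrow> real ^ ('n + 'n) \<Rightarrow> real) \<Rightarrow>
   real set \<Rightarrow> (real \<Rightarrow> real ^ ('n + 'n)) \<Rightarrow> bool" where
  "is_solution H \<Phi> T z \<longleftrightarrow>
     open T \<and> is_interval T \<and> smooth_on T z \<and>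
     (\<forall>\<tau>\<in>T. \<forall>i. ((\<lambda>s. z s $ i) has_real_derivative poisson (\<lambda>w. w $ i) H (z \<tau>)) (at \<tau>)) \<and>
     (\<forall>\<tau>\<in>T. \<forall>\<alpha>. \<Phi> \<alpha> (z \<tau>) = 0)"

end

theory Submission
  imports Defs
begin

text \<open>
  Along a solution the function \<open>\<Phi> \<alpha> \<circ> z\<close> vanishes on an open set of times, so its derivative is
  zero there.  By the chain rule and the equations of motion that derivative is the Poisson bracket
  of \<open>\<Phi> \<alpha>\<close> with \<open>H\<close>.
\<close>

lemma smooth_on_differentiable:
  assumes "smooth_on S f" "x \<in> S"
  shows "f differentiable (at x)"
  using assms Ck_on.simps(2)[of 0 S f] unfolding smooth_on_def by blast

text \<open>Bridge from the Frechet derivative to \<open>partial_deriv\<close>, which is a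
  one-variable derivative: apply the chain rule to \<open>f\<close> along the coordinate line
  through \<open>z\<close>.\<close>

lemma has_derivative_imp_partial_deriv:
  fixes f :: "real ^ 'i::finite \<Rightarrow> real"
  assumes "(f has_derivative f') (at z)"
  shows "partial_deriv i f z = f' (axis i 1)"
proof -
  interpret linear f'
    using assms by (rule has_derivative_linear)
  have "((\<lambda>t. z + t *\<^sub>R axis i 1) has_derivative (\<lambda>t. t *\<^sub>R axis i 1)) (at (0::real))"
    by (auto intro!: derivative_eq_intros)
  from has_derivative_compose[OF this, of f f'] assms
  have "((\<lambda>t. f (z + t *\<^sub>R axis i 1)) has_derivative (\<lambda>t. f' (t *\<^sub>R axis i 1))) (at 0)"
    by simp
  moreover have "(\<lambda>t. f' (t *\<^sub>R axis i 1)) = (*) (f' (axis i 1))"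
    by (simp add: fun_eq_iff scale)
  ultimately show ?thesis
    unfolding partial_deriv_def by (simp add: DERIV_imp_deriv has_field_derivative_def)
qed

lemma partial_deriv_coordinate:
  "partial_deriv i (\<lambda>w. w $ j) z = (if i = j then 1 else 0)"
proof -
  have "((\<lambda>w. w $ j) has_derivative (\<lambda>w. w $ j)) (at z)"
    by (rule bounded_linear_imp_has_derivative) (rule bounded_linear_vec_nth)
  from has_derivative_imp_partial_deriv[OF this] show ?thesis
    by (simp add: axis_def)
qed

text \<open>Together with \<open>poisson_coordinate_Inr\<close> this gives the right-hand sides of
  Hamilton's equations; the Kronecker deltas leave a single term of the sum over degrees of
  freedom.\<close>

lemma poisson_coordinate_Inl:
  "poisson (\<lambda>w. w $ Inl a) H z = partial_deriv (Inr a) H z"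
  by (simp add: poisson_def partial_deriv_coordinate if_distrib if_distribR cong: if_cong)

lemma poisson_coordinate_Inr:
  "poisson (\<lambda>w. w $ Inr a) H z = - partial_deriv (Inl a) H z"
  by (simp add: poisson_def partial_deriv_coordinate sum_negf if_distrib if_distribR cong: if_cong)

text \<open>The bracket with \<open>H\<close> is the derivative of \<open>F\<close> along the
  Hamiltonian vector field. Both sides are combinations of the same partial derivatives, so this is
  pure algebra.\<close>

lemma poisson_eq_sum_coordinates:
  fixes F H :: "real ^ ('n::finite + 'n) \<Rightarrow> real"
  shows "poisson F H z = (\<Sum>i\<in>UNIV. poisson (\<lambda>w. w $ i) H z * partial_deriv i F z)"
proof -
  have "(\<Sum>i\<in>UNIV. poisson (\<lambda>w. w $ i) H z * partial_deriv i F z) =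
      (\<Sum>a\<in>UNIV. poisson (\<lambda>w. w $ Inl a) H z * partial_deriv (Inl a) F z) +
      (\<Sum>a\<in>UNIV. poisson (\<lambda>w. w $ Inr a) H z * partial_deriv (Inr a) F z)"
    \<comment> \<open>The index type is a disjoint sum, so the sum splits into its position and
      momentum halves.\<close>
    unfolding UNIV_Plus_UNIV[symmetric] by (subst sum.Plus) simp_all
  then show ?thesis
    by (simp add: poisson_coordinate_Inl poisson_coordinate_Inr poisson_def
        sum_subtractf sum_negf mult.commute)
qed

text \<open>Chain rule in coordinates. The velocity is given by components \<open>v i\<close>
  because the equations of motion are stated that way.\<close>

lemma has_real_derivative_along_curve:
  fixes F :: "real ^ 'i::finite \<Rightarrow> real"
  assumes F: "F differentiable (at (z \<tau>))"
    and z: "\<And>i. ((\<lambda>s. z s $ i) has_real_derivative v i) (at \<tau>)"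
  shows "((\<lambda>s. F (z s)) has_real_derivative (\<Sum>i\<in>UNIV. v i * partial_deriv i F (z \<tau>))) (at \<tau>)"
proof -
  obtain F' where F': "(F has_derivative F') (at (z \<tau>))"
    using F by (auto simp: differentiable_def)
  interpret linear F'
    using F' by (rule has_derivative_linear)
  have "(z has_derivative (\<lambda>t. t *\<^sub>R (\<chi> i. v i))) (at \<tau>)"
    using z by (subst has_derivative_componentwise_within)
      (auto simp: Basis_vec_def inner_axis has_field_derivative_def mult.commute[of _ "v _"])
  from has_derivative_compose[OF this F']
  have "((\<lambda>s. F (z s)) has_derivative (\<lambda>t. F' (t *\<^sub>R (\<chi> i. v i)))) (at \<tau>)" .
  moreover have "F' (\<chi> i. v i) = (\<Sum>i\<in>UNIV. v i * partial_deriv i F (z \<tau>))"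
  proof -
    \<comment> \<open>Expanding the velocity in the standard basis lets linearity of
      \<open>F'\<close> produce the partial derivatives.\<close>
    have "(\<chi> i. v i) = (\<Sum>i\<in>UNIV. v i *\<^sub>R axis i 1)"
      using basis_expansion[of "\<chi> i. v i"] by (simp add: scalar_mult_eq_scaleR)
    then show ?thesis
      by (simp add: sum scale has_derivative_imp_partial_deriv[OF F'])
  qed
  ultimately show ?thesis
    by (simp add: has_field_derivative_def scale mult_commute_abs)
qed

theorem mainTheorem11:
  fixes H :: "real ^ ('n::finite + 'n) \<Rightarrow> real"
    and \<Phi> :: "'m::finite \<Rightarrow> real ^ ('n + 'n) \<Rightarrow> real"
    and p :: nat
  assumes "CARD('m) = 2 * p"
    and "2 * p < 2 * CARD('n)"
    and "smooth_on UNIV H"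
    and "\<And>\<alpha>. smooth_on UNIV (\<Phi> \<alpha>)"
    and "functionally_independent \<Phi>"
  shows "\<forall>T z. is_solution H \<Phi> T z \<longrightarrow> (\<forall>\<tau>\<in>T. \<forall>\<alpha>. poisson (\<Phi> \<alpha>) H (z \<tau>) = 0)"
proof (intro allI impI ballI)
  fix T z \<tau> \<alpha>
  assume sol: "is_solution H \<Phi> T z" and \<tau>: "\<tau> \<in> T"
  have T: "open T" and zero: "\<And>s. s \<in> T \<Longrightarrow> \<Phi> \<alpha> (z s) = 0"
    using sol by (auto simp: is_solution_def)
  have "((\<lambda>s. \<Phi> \<alpha> (z s)) has_real_derivative poisson (\<Phi> \<alpha>) H (z \<tau>)) (at \<tau>)"
    \<comment> \<open>Fixing the first argument keeps the rewriting from looping on the brackets of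
      coordinates that it creates. These brackets are the velocities prescribed by
      \<open>is_solution\<close>.\<close>
    unfolding poisson_eq_sum_coordinates[of "\<Phi> \<alpha>"]
    using sol \<tau> assms(4)
    by (intro has_real_derivative_along_curve smooth_on_differentiable[of UNIV])
      (auto simp: is_solution_def)
  moreover have "((\<lambda>s. \<Phi> \<alpha> (z s)) has_real_derivative 0) (at \<tau>)"
    by (rule has_field_derivative_transform_within_open[OF DERIV_const T \<tau>]) (simp add: zero)
  ultimately show "poisson (\<Phi> \<alpha>) H (z \<tau>) = 0"
    by (rule DERIV_unique)
qed

end
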